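(* Let $S_n$ and $s_n$ denote the large and small Schröder numbers, let $D_{\pm}(a_1,\ldots,a_n)$ denote the $n\times n$ Hessenberg--Toeplitz determinant with superdiagonal entries $\pm 1$, and let $A134425[n]$, $A225887[n]$, $A114710[n]$ ($n\ge 0$) be the integer sequences defined in the context. Then the following formulas hold for all $n\ge 1$, unless stated otherwise: \begin{align*} D_{+}(S_1,S_2,\ldots,S_n)&=(-1)^{n-1}S_{n-1}\quad (n\ge 2),\\ D_{-}(S_1,S_2,\ldots,S_n)&=2\cdot A134425[n-1],\\ D_{+}(S_0,S_1,\ldots,S_{n-1})&=(-1)^{n-1}s_{n-1},\\ D_{-}(S_0,S_1,\ldots,S_{n-1})&=s_n,\\ D_{+}(s_1,s_2,\ldots,s_n)&=(-1)^{n-1}S_{n-1},\\ D_{-}(s_1,s_2,\ldots,s_n)&=A225887[n-1],\\ D_{+}(s_0,s_1,\ldots,s_{n-1})&=(-1)^{n-1}A114710[n-1],\\ D_{-}(s_0,s_1,\ldots,s_{n-1})&=S_{n-1},\\ D_{+}(s_2,s_3,\ldots,s_{n+1})&=(-1)^{n-1}S_{n-1}\quad (n\ge 2). \end{align*}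
   Context: Large Schröder numbers: $S_0=1$ and $S_n=\frac1n\sum_{k=1}^n 2^k\binom nk\binom n{k-1}$ for $n\ge 1$. Small Schröder numbers: $s_0=1$ and $s_n=\frac12 S_n$ for $n\ge1$. Determinants: for $a_0\in\{1,-1\}$ and numbers $a_1,\ldots,a_n$, let $A_n(a_0;a_1,\ldots,a_n)$ be the $n\times n$ matrix whose $(i,j)$ entry is $a_{i-j+1}$ if $j\le i$, $a_0$ if $j=i+1$, and $0$ if $j>i+1$. Put $D_{+}(a_1,\ldots,a_n)=\det A_n(1;a_1,\ldots,a_n)$ and $D_{-}(a_1,\ldots,a_n)=\det A_n(-1;a_1,\ldots,a_n)$. Schröder paths: for $n\ge0$, $\mathcal P_n$ is the set of lattice paths from $(0,0)$ to $(2n,0)$ with steps $u=(1,1)$, $d=(1,-1)$, $h=(2,0)$ that never go below the $x$-axis ($\mathcal P_0$ consists of the empty path only). A low $h$ step is an $h$ step lying on the $x$-axis; $\mathrm{low}(\lambda)$ denotes the number of low $h$ steps of $\lambda$. A peak of height $1$ is a $u$ step ending at height $1$ immediately followed by a $d$ step. OEIS sequences ($n\ge 0$): $A134425[n]=\sum_{\lambda\in\mathcal P_n}4^{\mathrm{low}(\lambda)}$ (Schröder paths whose low $h$ steps come in four kinds); $A225887[n]=\sum_{\lambda\in\mathcal P_n}3^{\mathrm{low}(\lambda)}$ (Schröder paths whose low $h$ steps come in three colors); $A114710[n]$ is the number of $\lambda\in\mathcal P_n$ having no low $h$ steps and no peaks of height $1$. *)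

theory Defs
  imports "Jordan_Normal_Form.Determinant"
begin

definition large_schroeder :: "nat \<Rightarrow> rat" where
  "large_schroeder n =
     (if n = 0 then 1
      else 1 / of_nat n * (\<Sum>k = 1..n. 2 ^ k * of_nat (n choose k) * of_nat (n choose (k - 1))))"

definition small_schroeder :: "nat \<Rightarrow> rat" where
  "small_schroeder n = (if n = 0 then 1 else 1 / 2 * large_schroeder n)"

(* The list as = [a_1, ..., a_n] is indexed from 0, as are the rows and columns of mat,
   so the entry a_(i-j+1) on and below the diagonal is as ! (i - j). *)
definition hessenberg_toeplitz :: "'a::comm_ring_1 \<Rightarrow> 'a list \<Rightarrow> 'a mat" where
  "hessenberg_toeplitz a0 as =
     mat (length as) (length as)
       (\<lambda>(i, j). if j \<le> i then as ! (i - j) else if j = i + 1 then a0 else 0)"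

definition D_plus :: "'a::comm_ring_1 list \<Rightarrow> 'a" where
  "D_plus as = det (hessenberg_toeplitz 1 as)"

definition D_minus :: "'a::comm_ring_1 list \<Rightarrow> 'a" where
  "D_minus as = det (hessenberg_toeplitz (- 1) as)"

datatype step = U | D | H

fun step_vec :: "step \<Rightarrow> int \<times> int" where
  "step_vec U = (1, 1)"
| "step_vec D = (1, - 1)"
| "step_vec H = (2, 0)"

definition endpoint :: "step list \<Rightarrow> int \<times> int" where
  "endpoint p = (\<Sum>s\<leftarrow>p. fst (step_vec s), \<Sum>s\<leftarrow>p. snd (step_vec s))"

definition height :: "step list \<Rightarrow> nat \<Rightarrow> int" where
  "height p k = snd (endpoint (take k p))"

(* All steps are straight segments, so staying weakly above the x-axis is a condition
   on the vertices only. *)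
definition schroeder_paths :: "nat \<Rightarrow> step list set" where
  "schroeder_paths n =
     {p. endpoint p = (2 * int n, 0) \<and> (\<forall>k\<le>length p. 0 \<le> height p k)}"

definition low :: "step list \<Rightarrow> nat" where
  "low p = card {k. k < length p \<and> p ! k = H \<and> height p k = 0}"

definition has_peak1 :: "step list \<Rightarrow> bool" where
  "has_peak1 p \<longleftrightarrow>
     (\<exists>k. k + 1 < length p \<and> p ! k = U \<and> p ! (k + 1) = D \<and> height p (k + 1) = 1)"

definition A134425 :: "nat \<Rightarrow> nat" where
  "A134425 n = (\<Sum>p\<in>schroeder_paths n. 4 ^ low p)"

definition A225887 :: "nat \<Rightarrow> nat" where
  "A225887 n = (\<Sum>p\<in>schroeder_paths n. 3 ^ low p)"

definition A114710 :: "nat \<Rightarrow> nat" where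
  "A114710 n = card {p \<in> schroeder_paths n. low p = 0 \<and> \<not> has_peak1 p}"

(* Finiteness makes the sums and the cardinality above the intended ones: sum and card
   are 0 on infinite sets. *)
lemma finite_schroeder_paths: "finite (schroeder_paths n)"
proof -
  have len: "int (length p) \<le> fst (endpoint p)" for p
  proof (induction p)
    case Nil
    then show ?case by (simp add: endpoint_def)
  next
    case (Cons s p)
    then show ?case by (cases s) (simp_all add: endpoint_def)
  qed
  have "schroeder_paths n \<subseteq> {p. set p \<subseteq> {U, D, H} \<and> length p \<le> 2 * n}"
  proof
    fix p assume "p \<in> schroeder_paths n"
    then have "length p \<le> 2 * n"
      using len[of p] by (simp add: schroeder_paths_def)
    moreover have "set p \<subseteq> {U, D, H}"
      using step.exhaust by blast
    ultimately show "p \<in> {p. set p \<subseteq> {U, D, H} \<and> length p \<le> 2 * n}" by simp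
  qed
  then show ?thesis
    by (rule finite_subset) (simp add: finite_lists_length_le)
qed

end

theory Submission
  imports Defs "HOL-Computational_Algebra.Formal_Power_Series"
begin

text \<open>
  Let \<open>S\<close> be the generating function of the large Schroeder numbers.  Lagrange inversion predicts a
  closed form for the coefficients of \<open>S ^ r\<close>; the resulting series \<open>N r\<close> satisfy
  \<open>N (r + 1) = N r + x (N (r + 1) + N (r + 2))\<close>, whose solutions form a geometric progression,
  and this gives \<open>S = 1 + x S + x S\<^sup>2\<close> without using the inversion theorem.  Schroeder paths from
  height \<open>h\<close> down to the axis, split by their first step, satisfy the same recurrence in \<open>h\<close>, so
  weighting the low \<open>h\<close> steps by \<open>c\<close> yields the generating function \<open>1 / (1 - c x - x S)\<close>.
  The Hessenberg-Toeplitz determinants with entries \<open>a i\<close> and superdiagonal \<open>\<plusminus> 1\<close> have, up to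
  signs, the generating function \<open>1 / (1 \<plusminus> A)\<close> with \<open>A\<close> that of the entries.  All nine formulas
  thereby become consequences of the quadratic equation for \<open>S\<close>.
\<close>

section \<open>Closed form for the powers of the Schroeder series\<close>

text \<open>The coefficient of \<open>x ^ m\<close> in \<open>S ^ r\<close>, as predicted by Lagrange inversion for
  \<open>T = x (1 + T) (2 + T)\<close> with \<open>T = S - 1\<close>.\<close>

definition schroeder_ladder :: "nat \<Rightarrow> nat \<Rightarrow> rat" where
  "schroeder_ladder r m = (if m = 0 then 1 else of_nat r / of_nat m *
     poly.coeff ([:1, 1:] ^ (m - 1 + r) * [:2, 1:] ^ m) (m - 1))"

lemma schroeder_ladder_0 [simp]: "schroeder_ladder r 0 = 1"
  and schroeder_ladder_0_Suc [simp]: "schroeder_ladder 0 (Suc m) = 0"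
  by (simp_all add: schroeder_ladder_def)

lemma linear_factors: "[:2, 3, 1 :: rat:] = [:1, 1:] * [:2, 1:]"
  by simp

text \<open>Compare coefficients of \<open>x^k\<close> in the derivative of
  \<open>Q = P (1 + x) (2 + x)\<close>: the product rule leaves \<open>P\<close> times a linear
  polynomial. \<open>pCons 0 P\<close> supplies the coefficient at \<open>k - 1\<close>, with value
  0 for \<open>k = 0\<close>.\<close>

lemma coeff_Suc_power_product:
  fixes P :: "rat poly"
  assumes "P = [:1, 1:] ^ a * [:2, 1:] ^ b"
  shows "of_nat (Suc k) * (2 * poly.coeff P (Suc k) + 3 * poly.coeff P k + poly.coeff (pCons 0 P) k) =
    of_nat (2 * a + b + 3) * poly.coeff P k + of_nat (a + b + 2) * poly.coeff (pCons 0 P) k"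
proof -
  define Q :: "rat poly" where "Q = [:1, 1:] ^ Suc a * [:2, 1:] ^ Suc b"
  have Q: "Q = P * [:2, 3, 1:]"
    unfolding Q_def assms linear_factors by (simp only: power_Suc ac_simps)
  have "pderiv Q = P * [:of_nat (2 * a + b + 3), of_nat (a + b + 2):]"
  proof -
    have "pderiv Q = smult (of_nat (Suc a)) ([:1, 1:] ^ a) * [:2, 1:] ^ Suc b
        + [:1, 1:] ^ Suc a * smult (of_nat (Suc b)) ([:2, 1:] ^ b)"
      unfolding Q_def pderiv_mult pderiv_power_Suc by (simp add: pderiv_pCons mult.commute)
    also have "\<dots> = P * (smult (of_nat (Suc a)) [:2, 1:] + smult (of_nat (Suc b)) [:1, 1:])"
      unfolding assms power_Suc by (simp only: ring_distribs mult_smult_left mult_smult_right ac_simps)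
    also have "smult (of_nat (Suc a)) [:2, 1:] + smult (of_nat (Suc b)) [:1, 1:] =
        [:of_nat (2 * a + b + 3), of_nat (a + b + 2) :: rat:]"
      by simp
    finally show ?thesis .
  qed
  moreover have "of_nat (Suc k) * poly.coeff Q (Suc k) = poly.coeff (pderiv Q) k"
    by (simp only: coeff_pderiv)
  moreover have "poly.coeff Q (Suc k) =
      2 * poly.coeff P (Suc k) + 3 * poly.coeff P k + poly.coeff (pCons 0 P) k"
    unfolding Q by (simp add: coeff_pCons split: nat.split)
  moreover have "poly.coeff (P * [:of_nat (2 * a + b + 3), of_nat (a + b + 2):]) k =
      of_nat (2 * a + b + 3) * poly.coeff P k + of_nat (a + b + 2) * poly.coeff (pCons 0 P) k"
    by (simp add: coeff_pCons split: nat.split)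
  ultimately show ?thesis by simp
qed

text \<open>For \<open>m = k + 1\<close> all four values are rational multiples of coefficients of
  \<open>P\<close> times a divisor of \<open>(1 + x) (2 + x)\<close>; clearing denominators reduces
  the claim to \<open>coeff_Suc_power_product\<close>.\<close>

lemma schroeder_ladder_Suc:
  "schroeder_ladder (Suc r) (Suc m) =
     schroeder_ladder r (Suc m) + schroeder_ladder (Suc r) m + schroeder_ladder (Suc (Suc r)) m"
proof (cases m)
  case 0
  then show ?thesis
    by (simp add: schroeder_ladder_def coeff_mult poly_0_coeff_0[symmetric] poly_power)
next
  case (Suc k)
  define P :: "rat poly" where "P = [:1, 1:] ^ (k + 1 + r) * [:2, 1:] ^ (k + 1)"
  define x where "x = poly.coeff P (Suc k)"
  define y where "y = poly.coeff P k"
  define z where "z = poly.coeff (pCons 0 P) k"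
  define K R :: rat where "K = of_nat k" and "R = of_nat r"
  have K: "K + 1 \<noteq> 0" "K + 2 \<noteq> 0"
    unfolding K_def by linarith+
  have "of_nat (Suc k) * (2 * x + 3 * y + z) =
      of_nat (2 * (k + 1 + r) + (k + 1) + 3) * y + of_nat ((k + 1 + r) + (k + 1) + 2) * z"
    unfolding x_def y_def z_def by (rule coeff_Suc_power_product[OF P_def])
  then have rel: "(K + 1) * (2 * x + 3 * y + z) = (3 * K + 2 * R + 6) * y + (2 * K + R + 4) * z"
    by (simp add: K_def R_def algebra_simps)
  have "[:1, 1:] ^ (Suc k + Suc r) * [:2, 1:] ^ Suc (Suc k) = P * [:2, 3, 1:]"
    unfolding P_def linear_factors by (simp only: power_add power_Suc power_one_right ac_simps)
  then have a: "schroeder_ladder (Suc r) (Suc m) = (R + 1) / (K + 2) * (2 * x + 3 * y + z)"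
    by (simp add: schroeder_ladder_def Suc K_def R_def x_def y_def z_def coeff_pCons add_ac
        del: power_Suc split: nat.split)
  have "[:1, 1:] ^ (Suc k + r) * [:2, 1:] ^ Suc (Suc k) = P * [:2, 1:]"
    unfolding P_def linear_factors by (simp only: power_add power_Suc power_one_right ac_simps)
  then have b: "schroeder_ladder r (Suc m) = R / (K + 2) * (2 * x + y)"
    by (simp add: schroeder_ladder_def Suc K_def R_def x_def y_def z_def coeff_pCons add_ac
        del: power_Suc split: nat.split)
  have "[:1, 1:] ^ (k + Suc r) * [:2, 1:] ^ Suc k = P"
    unfolding P_def by simp
  then have c: "schroeder_ladder (Suc r) m = (R + 1) / (K + 1) * y"
    by (simp add: schroeder_ladder_def Suc K_def R_def y_def add_ac del: power_Suc)
  have "[:1, 1:] ^ (k + Suc (Suc r)) * [:2, 1:] ^ Suc k = P * [:1, 1:]"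
    unfolding P_def linear_factors by (simp only: power_add power_Suc power_one_right ac_simps)
  then have d: "schroeder_ladder (Suc (Suc r)) m = (R + 2) / (K + 1) * (y + z)"
    by (simp add: schroeder_ladder_def Suc K_def R_def y_def z_def coeff_pCons add_ac
        del: power_Suc split: nat.split)
  have "(K + 1) * ((R + 1) * (2 * x + 3 * y + z)) =
      (K + 1) * (R * (2 * x + y)) + (K + 2) * ((R + 1) * y + (R + 2) * (y + z))"
    using rel by (simp add: algebra_simps)
  then show ?thesis
    unfolding a b c d using K by (simp add: divide_simps) (simp add: algebra_simps)
qed

text \<open>Convolving the two binomial expansions and putting \<open>k = i + 1\<close> gives the
  defining sum.\<close>

lemma schroeder_ladder_1: "schroeder_ladder 1 n = large_schroeder n"
proof (cases n)
  case 0
  then show ?thesis by (simp add: large_schroeder_def)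
next
  case (Suc m)
  have "poly.coeff ([:1, 1:] ^ n * [:2, 1:] ^ n :: rat poly) m =
      (\<Sum>i\<le>m. 2 ^ Suc i * of_nat (n choose Suc i) * of_nat (n choose i))"
    unfolding coeff_mult
  proof (rule sum.cong)
    fix i assume i: "i \<in> {..m}"
    then have "n - (m - i) = Suc i" "n choose (m - i) = n choose Suc i"
      using Suc binomial_symmetric[of "Suc i" n] by auto
    then show "poly.coeff ([:1, 1:] ^ n) i * poly.coeff ([:2, 1:] ^ n) (m - i) =
        (2 ^ Suc i * of_nat (n choose Suc i) * of_nat (n choose i) :: rat)"
      using coeff_linear_poly_power[of i n 1 "1 :: rat"]
        coeff_linear_poly_power[of "m - i" n 2 "1 :: rat"] i Suc
      by (simp del: power_Suc binomial_Suc_Suc)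
  qed simp
  also have "\<dots> = (\<Sum>k = 1..n. 2 ^ k * of_nat (n choose k) * of_nat (n choose (k - 1)))"
    unfolding Suc One_nat_def sum.shift_bounds_cl_Suc_ivl atMost_atLeast0 by simp
  finally show ?thesis
    unfolding schroeder_ladder_def large_schroeder_def using Suc by simp
qed

section \<open>Ladder recurrences and the quadratic equation\<close>

text \<open>The difference \<open>E\<close> solves the same linear recurrence with
  \<open>E 0 = 0\<close>. Its coefficient at \<open>m\<close> is that of the rung below plus
  coefficients at \<open>m - 1\<close>, so induction on \<open>m\<close>, then on \<open>r\<close>,
  makes it vanish.\<close>

lemma fps_ladder_unique:
  fixes F G :: "nat \<Rightarrow> 'a::comm_ring_1 fps"
  assumes F: "\<And>r. F (Suc r) = F r + fps_X * (F (Suc r) + F (Suc (Suc r)))"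
    and G: "\<And>r. G (Suc r) = G r + fps_X * (G (Suc r) + G (Suc (Suc r)))"
    and "G 0 = 1"
  shows "F r = F 0 * G r"
proof -
  define E where "E r = F r - F 0 * G r" for r
  have E_rec: "E (Suc r) = E r + fps_X * (E (Suc r) + E (Suc (Suc r)))" for r
    unfolding E_def by (subst F, subst G) (simp add: algebra_simps)
  have E_0: "E 0 = 0"
    by (simp add: E_def \<open>G 0 = 1\<close>)
  have "fps_nth (E r) m = 0" for r m
  proof (induction m arbitrary: r)
    case 0
    show ?case
      by (induction r) (simp add: E_0, subst E_rec, simp)
  next
    case (Suc m)
    show ?case
      by (induction r) (simp add: E_0, subst E_rec, simp add: Suc)
  qed
  then have "E r = 0"
    by (simp add: fps_eq_iff)
  then show ?thesis
    by (simp add: E_def)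
qed

definition large_fps :: "rat fps" where
  "large_fps = Abs_fps large_schroeder"

definition ladder_fps :: "nat \<Rightarrow> rat fps" where
  "ladder_fps r = Abs_fps (schroeder_ladder r)"

lemma ladder_fps_0: "ladder_fps 0 = 1"
  by (rule fps_ext) (auto simp: ladder_fps_def gr0_conv_Suc)

lemma ladder_fps_1: "ladder_fps (Suc 0) = large_fps"
  using schroeder_ladder_1 by (simp add: ladder_fps_def large_fps_def fps_eq_iff)

lemma ladder_fps_Suc:
  "ladder_fps (Suc r) = ladder_fps r + fps_X * (ladder_fps (Suc r) + ladder_fps (Suc (Suc r)))"
proof (rule fps_ext)
  show "fps_nth (ladder_fps (Suc r)) m =
      fps_nth (ladder_fps r + fps_X * (ladder_fps (Suc r) + ladder_fps (Suc (Suc r)))) m" for m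
    by (cases m) (simp_all add: ladder_fps_def schroeder_ladder_Suc)
qed

text \<open>The ladder shifted by one rung is again a solution, with bottom rung S; uniqueness at
  rung 1 says that rung 2 is the square of S.\<close>

lemma large_fps_eq: "large_fps = 1 + fps_X * (large_fps + large_fps\<^sup>2)"
proof -
  have "ladder_fps (Suc (Suc 0)) = ladder_fps (Suc 0) * ladder_fps (Suc 0)"
    using fps_ladder_unique[of "\<lambda>r. ladder_fps (Suc r)" ladder_fps "Suc 0"]
      ladder_fps_Suc ladder_fps_0 by blast
  then show ?thesis
    using ladder_fps_Suc[of 0] by (simp add: ladder_fps_0 ladder_fps_1 power2_eq_square)
qed

section \<open>Hessenberg-Toeplitz determinants\<close>

text \<open>Leaving the first column arbitrary makes the expansion along the first row stay in the
  family.\<close>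

definition bordered_hessenberg ::
    "'a::comm_ring_1 \<Rightarrow> (nat \<Rightarrow> 'a) \<Rightarrow> (nat \<Rightarrow> 'a) \<Rightarrow> nat \<Rightarrow> 'a mat" where
  "bordered_hessenberg a0 c a n = mat n n
     (\<lambda>(i, j). if j = 0 then c i else if j \<le> i then a (i - j) else if j = i + 1 then a0 else 0)"

lemma bordered_hessenberg_carrier: "bordered_hessenberg a0 c a n \<in> carrier_mat n n"
  by (simp add: bordered_hessenberg_def)

lemma hessenberg_toeplitz_conv:
  "hessenberg_toeplitz a0 (map f [k..<k + n]) =
     bordered_hessenberg a0 (\<lambda>i. f (k + i)) (\<lambda>i. f (k + i)) n"
  by (rule eq_matI) (auto simp: hessenberg_toeplitz_def bordered_hessenberg_def)

text \<open>Only two entries of the first row can be nonzero. Deleting column 0 promotes a Toeplitz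
  column to first column; deleting column 1 keeps the free column, shifted by one.\<close>

lemma det_bordered_hessenberg_Suc_Suc:
  "det (bordered_hessenberg a0 c a (Suc (Suc n))) =
     c 0 * det (bordered_hessenberg a0 a a (Suc n))
     - a0 * det (bordered_hessenberg a0 (\<lambda>i. c (Suc i)) a (Suc n))"
proof -
  let ?A = "bordered_hessenberg a0 c a (Suc (Suc n))"
  have row: "?A $$ (0, j) = (if j = 0 then c 0 else if j = 1 then a0 else 0)"
    if "j < Suc (Suc n)" for j
    using that by (auto simp: bordered_hessenberg_def)
  have "mat_delete ?A 0 0 = bordered_hessenberg a0 a a (Suc n)"
    by (rule eq_matI) (auto simp: mat_delete_def bordered_hessenberg_def)
  moreover have "mat_delete ?A 0 1 = bordered_hessenberg a0 (\<lambda>i. c (Suc i)) a (Suc n)"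
    by (rule eq_matI) (auto simp: mat_delete_def bordered_hessenberg_def)
  moreover have "det ?A = (\<Sum>j<Suc (Suc n). ?A $$ (0, j) * cofactor ?A 0 j)"
    by (rule laplace_expansion_row[OF bordered_hessenberg_carrier]) simp
  moreover have "\<dots> = c 0 * cofactor ?A 0 0 + a0 * cofactor ?A 0 1"
    by (simp add: row sum.lessThan_Suc_shift del: sum.lessThan_Suc)
  ultimately show ?thesis
    by (simp add: cofactor_def)
qed

text \<open>Iterating the expansion, each shift of the free column costs a factor
  \<open>- a0\<close>.\<close>

lemma det_bordered_hessenberg_Suc:
  "det (bordered_hessenberg a0 c a (Suc n)) =
     (\<Sum>i\<le>n. (- a0) ^ i * c i * det (bordered_hessenberg a0 a a (n - i)))"
proof (induction n arbitrary: c)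
  case 0
  show ?case
    by (simp add: det_dim_zero[OF bordered_hessenberg_carrier])
      (simp add: bordered_hessenberg_def det_single)
next
  case (Suc n)
  show ?case
    unfolding det_bordered_hessenberg_Suc_Suc Suc.IH[of "\<lambda>i. c (Suc i)"]
    by (simp add: sum.atMost_Suc_shift sum_distrib_left sum_negf[symmetric] mult.assoc
        del: sum.atMost_Suc)
qed

text \<open>The scaling by \<open>(- a0) ^ n\<close> absorbs the powers in
  \<open>det_bordered_hessenberg_Suc\<close>, as \<open>a0\<close> squares to 1; what remains is a
  plain convolution.\<close>

lemma fps_det_bordered_hessenberg:
  fixes a0 :: "'a::comm_ring_1"
  assumes "a0 * a0 = 1"
  shows "Abs_fps (\<lambda>n. (- a0) ^ n * det (bordered_hessenberg a0 a a n)) *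
    (1 + fps_const a0 * fps_X * Abs_fps a) = 1"
proof -
  let ?d = "\<lambda>n. det (bordered_hessenberg a0 a a n)"
  let ?E = "Abs_fps (\<lambda>n. (- a0) ^ n * ?d n)"
  have sq: "(- a0) ^ i * (- a0) ^ i = 1" for i
    using assms by (simp flip: power_mult_distrib)
  have "?E = 1 - fps_const a0 * (fps_X * (Abs_fps a * ?E))"
  proof (rule fps_ext)
    fix n
    show "fps_nth ?E n = fps_nth (1 - fps_const a0 * (fps_X * (Abs_fps a * ?E))) n"
    proof (cases n)
      case 0
      then show ?thesis
        by (simp add: det_dim_zero[OF bordered_hessenberg_carrier])
    next
      case (Suc m)
      have "(- a0) ^ m * ?d (Suc m) = (\<Sum>i\<le>m. a i * ((- a0) ^ (m - i) * ?d (m - i)))"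
        unfolding det_bordered_hessenberg_Suc sum_distrib_left
      proof (rule sum.cong)
        fix i assume "i \<in> {..m}"
        then have "(- a0) ^ m = (- a0) ^ i * (- a0) ^ (m - i)"
          by (simp flip: power_add)
        then have "(- a0) ^ m * ((- a0) ^ i * a i * ?d (m - i)) =
            ((- a0) ^ i * (- a0) ^ i) * (a i * ((- a0) ^ (m - i) * ?d (m - i)))"
          by (simp only: ac_simps)
        then show "(- a0) ^ m * ((- a0) ^ i * a i * ?d (m - i)) =
            a i * ((- a0) ^ (m - i) * ?d (m - i))"
          by (simp only: sq mult_1_left)
      qed simp
      then show ?thesis
        by (simp add: Suc fps_mult_nth[of "Abs_fps a"] atLeast0AtMost mult.assoc)
    qed
  qed
  then show ?thesis
    by (simp add: algebra_simps)
qed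

text \<open>Inverses are unique, so it suffices to exhibit some inverse \<open>P\<close> of the
  series and read off its coefficients.\<close>

lemma det_hessenberg_toeplitz_eq:
  fixes a0 :: "'a::idom"
  assumes "a0 * a0 = 1"
    and P: "P * (1 + fps_const a0 * fps_X * Abs_fps (\<lambda>i. f (k + i))) = 1"
  shows "det (hessenberg_toeplitz a0 (map f [k..<k + n])) = (- a0) ^ n * fps_nth P n"
proof -
  define d where "d n = det (hessenberg_toeplitz a0 (map f [k..<k + n]))" for n
  define M where "M = 1 + fps_const a0 * fps_X * Abs_fps (\<lambda>i. f (k + i))"
  define E where "E = Abs_fps (\<lambda>n. (- a0) ^ n * d n)"
  have "E * M = 1"
    unfolding E_def M_def d_def hessenberg_toeplitz_conv
    by (rule fps_det_bordered_hessenberg[OF assms(1)])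
  have "P = P * (E * M)"
    by (simp add: \<open>E * M = 1\<close>)
  also have "\<dots> = P * M * E"
    by (simp only: ac_simps)
  finally have "fps_nth P n = (- a0) ^ n * d n"
    using P by (simp add: M_def E_def)
  moreover have "(- a0) ^ n * (- a0) ^ n = 1"
    using assms by (simp flip: power_mult_distrib)
  ultimately show ?thesis
    by (simp add: d_def flip: mult.assoc)
qed

text \<open>The separate bound \<open>l\<close> lets intervals such as \<open>[1..<n + 1]\<close>
  match literally.\<close>

lemma D_plus_eq:
  fixes f :: "nat \<Rightarrow> 'a::idom"
  assumes "P * (1 + fps_X * Abs_fps (\<lambda>i. f (k + i))) = 1" and "l = k + n"
  shows "D_plus (map f [k..<l]) = (- 1) ^ n * fps_nth P n"
  unfolding D_plus_def \<open>l = k + n\<close> by (rule det_hessenberg_toeplitz_eq) (use assms in simp_all)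

lemma D_minus_eq:
  fixes f :: "nat \<Rightarrow> 'a::idom"
  assumes "P * (1 - fps_X * Abs_fps (\<lambda>i. f (k + i))) = 1" and "l = k + n"
  shows "D_minus (map f [k..<l]) = fps_nth P n"
  unfolding D_minus_def \<open>l = k + n\<close>
  using det_hessenberg_toeplitz_eq[of "- 1" P f k n] assms by (simp flip: fps_const_neg)

section \<open>Schroeder paths by starting height and first step\<close>

text \<open>The parameter \<open>m\<close> counts the \<open>U\<close> and \<open>H\<close> steps; a path from height \<open>h\<close> to the axis then has
  horizontal extent \<open>2 m + h\<close>.  The paths are translated to start at the origin.\<close>

definition paths_from :: "nat \<Rightarrow> nat \<Rightarrow> step list set" where
  "paths_from h m = {p. endpoint p = (2 * int m + int h, - int h) \<and>
     (\<forall>k\<le>length p. 0 \<le> int h + height p k)}"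

text \<open>The starting height is an integer because the recursion over an arbitrary step list may
  pass below the axis.\<close>

definition low_from :: "int \<Rightarrow> step list \<Rightarrow> nat" where
  "low_from z p = card {k. k < length p \<and> p ! k = H \<and> z + height p k = 0}"

definition peak1_from :: "int \<Rightarrow> step list \<Rightarrow> bool" where
  "peak1_from z p \<longleftrightarrow>
     (\<exists>k. k + 1 < length p \<and> p ! k = U \<and> p ! (k + 1) = D \<and> z + height p (k + 1) = 1)"

lemma schroeder_paths_conv: "schroeder_paths n = paths_from 0 n"
  by (simp add: schroeder_paths_def paths_from_def)

lemma low_conv: "low p = low_from 0 p"
  by (simp add: low_def low_from_def)

lemma has_peak1_conv: "has_peak1 p \<longleftrightarrow> peak1_from 0 p"
  by (simp add: has_peak1_def peak1_from_def)

lemma endpoint_Nil [simp]: "endpoint [] = (0, 0)"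
  by (simp add: endpoint_def)

lemma endpoint_Cons: "endpoint (s # p) =
    (fst (step_vec s) + fst (endpoint p), snd (step_vec s) + snd (endpoint p))"
  by (simp add: endpoint_def)

lemma height_0 [simp]: "height p 0 = 0"
  by (simp add: height_def)

lemma height_Cons_Suc [simp]: "height (s # p) (Suc k) = snd (step_vec s) + height p k"
  by (simp add: height_def endpoint_Cons)

text \<open>\<open>U\<close> and \<open>H\<close> raise the sum of the coordinates by 2 and
  \<open>D\<close> preserves it. Hence no \<open>U\<close> or \<open>H\<close> occurs when
  \<open>m = 0\<close>.\<close>

lemma endpoint_nonneg: "0 \<le> fst (endpoint p) + snd (endpoint p)"
proof (induction p)
  case (Cons s p)
  then show ?case by (cases s) (simp_all add: endpoint_Cons)
qed simp

lemma all_le_Suc_conv: "(\<forall>k\<le>Suc n. P k) \<longleftrightarrow> P 0 \<and> (\<forall>k\<le>n. P (Suc k))"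
  by (metis Suc_le_mono not0_implies_Suc zero_le)

lemma Nil_in_paths_from: "[] \<in> paths_from h m \<longleftrightarrow> h = 0 \<and> m = 0"
  by (auto simp: paths_from_def)

lemma U_in_paths_from:
  "U # p \<in> paths_from h m \<longleftrightarrow> (\<exists>m'. m = Suc m' \<and> p \<in> paths_from (Suc h) m')"
proof (cases m)
  case 0
  then show ?thesis
    using endpoint_nonneg[of p] by (auto simp: paths_from_def endpoint_Cons)
next
  case (Suc m')
  then show ?thesis
    by (auto simp: paths_from_def endpoint_Cons all_le_Suc_conv prod_eq_iff algebra_simps)
qed

lemma H_in_paths_from:
  "H # p \<in> paths_from h m \<longleftrightarrow> (\<exists>m'. m = Suc m' \<and> p \<in> paths_from h m')"
proof (cases m)
  case 0
  then show ?thesis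
    using endpoint_nonneg[of p] by (auto simp: paths_from_def endpoint_Cons)
next
  case (Suc m')
  then show ?thesis
    by (auto simp: paths_from_def endpoint_Cons all_le_Suc_conv prod_eq_iff algebra_simps)
qed

lemma D_in_paths_from:
  "D # p \<in> paths_from h m \<longleftrightarrow> (\<exists>h'. h = Suc h' \<and> p \<in> paths_from h' m)"
proof (cases h)
  case 0
  then show ?thesis
    \<comment> \<open>The witness 0 denotes the vertex just after the \<open>D\<close> step, at
      height -1.\<close>
    by (auto simp: paths_from_def all_le_Suc_conv intro!: exI[of _ 0])
next
  case (Suc h')
  then show ?thesis
    by (auto simp: paths_from_def endpoint_Cons all_le_Suc_conv prod_eq_iff algebra_simps)
qed

lemmas Cons_in_paths_from = U_in_paths_from H_in_paths_from D_in_paths_from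

lemma mem_Cons_image_iff: "p \<in> (#) s ` A \<longleftrightarrow> (\<exists>q\<in>A. p = s # q)"
  by blast

lemma paths_from_0_0: "paths_from 0 0 = {[]}"
  and paths_from_Suc_0: "paths_from (Suc h) 0 = (#) D ` paths_from h 0"
  and paths_from_0_Suc:
    "paths_from 0 (Suc m) = (#) H ` paths_from 0 m \<union> (#) U ` paths_from (Suc 0) m"
  and paths_from_Suc_Suc: "paths_from (Suc h) (Suc m) = (#) D ` paths_from h (Suc m) \<union>
    ((#) H ` paths_from (Suc h) m \<union> (#) U ` paths_from (Suc (Suc h)) m)"
proof -
  note simps = mem_Cons_image_iff Cons_in_paths_from Nil_in_paths_from
  have "p \<in> paths_from 0 0 \<longleftrightarrow> p \<in> {[]}"
    "p \<in> paths_from (Suc h) 0 \<longleftrightarrow> p \<in> (#) D ` paths_from h 0"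
    "p \<in> paths_from 0 (Suc m) \<longleftrightarrow>
      p \<in> (#) H ` paths_from 0 m \<union> (#) U ` paths_from (Suc 0) m"
    "p \<in> paths_from (Suc h) (Suc m) \<longleftrightarrow> p \<in> (#) D ` paths_from h (Suc m) \<union>
      ((#) H ` paths_from (Suc h) m \<union> (#) U ` paths_from (Suc (Suc h)) m)" for p
    by (cases p; cases "hd p"; simp add: simps)+
  then show "paths_from 0 0 = {[]}"
    "paths_from (Suc h) 0 = (#) D ` paths_from h 0"
    "paths_from 0 (Suc m) = (#) H ` paths_from 0 m \<union> (#) U ` paths_from (Suc 0) m"
    "paths_from (Suc h) (Suc m) = (#) D ` paths_from h (Suc m) \<union>
      ((#) H ` paths_from (Suc h) m \<union> (#) U ` paths_from (Suc (Suc h)) m)"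
    by (simp_all add: set_eq_iff)
qed

text \<open>A \<open>U\<close> step raises \<open>h\<close> but lowers \<open>m\<close>, so the
  outer induction is on \<open>m\<close> for all \<open>h\<close>.\<close>

lemma finite_paths_from: "finite (paths_from h m)"
proof (induction m arbitrary: h)
  case 0
  show ?case
    by (induction h) (simp_all add: paths_from_0_0 paths_from_Suc_0)
next
  case (Suc m)
  show ?case
    by (induction h) (simp_all add: paths_from_0_Suc paths_from_Suc_Suc Suc)
qed

lemma low_from_Nil [simp]: "low_from z [] = 0"
  by (simp add: low_from_def)

lemma low_from_Cons [simp]:
  "low_from z (s # p) = of_bool (s = H \<and> z = 0) + low_from (z + snd (step_vec s)) p"
proof -
  let ?B = "{k. k < length p \<and> p ! k = H \<and> z + snd (step_vec s) + height p k = 0}"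
  have "k \<in> {k. k < length (s # p) \<and> (s # p) ! k = H \<and> z + height (s # p) k = 0} \<longleftrightarrow>
      k \<in> (if s = H \<and> z = 0 then {0} else {}) \<union> Suc ` ?B" for k
    by (cases k) (auto simp: add.assoc)
  then have "{k. k < length (s # p) \<and> (s # p) ! k = H \<and> z + height (s # p) k = 0} =
      (if s = H \<and> z = 0 then {0} else {}) \<union> Suc ` ?B"
    by blast
  moreover have "card ((if s = H \<and> z = 0 then {0} else {}) \<union> Suc ` ?B) =
      of_bool (s = H \<and> z = 0) + card ?B"
    by (simp add: card_image card_insert_if image_iff)
  ultimately show ?thesis
    by (simp only: low_from_def)
qed

lemma peak1_from_Nil [simp]: "\<not> peak1_from z []"
  by (simp add: peak1_from_def)

lemma peak1_from_Cons [simp]: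
  "peak1_from z (s # p) \<longleftrightarrow>
     s = U \<and> z = 0 \<and> p \<noteq> [] \<and> hd p = D \<or> peak1_from (z + snd (step_vec s)) p"
proof -
  have ex_Suc: "(\<exists>k. Q k) \<longleftrightarrow> Q 0 \<or> (\<exists>k. Q (Suc k))" for Q :: "nat \<Rightarrow> bool"
    by (metis not0_implies_Suc)
  show ?thesis
    unfolding peak1_from_def
    by (subst ex_Suc, cases p) (auto simp: add.assoc)
qed

section \<open>Generating functions of weighted paths\<close>

text \<open>A \<open>D\<close> step leaves \<open>m\<close> unchanged and so contributes no factor
  x; \<open>H\<close> and \<open>U\<close> contribute one each.\<close>

lemma path_fps_ladder:
  fixes f :: "nat \<Rightarrow> nat \<Rightarrow> 'a::comm_ring_1"
  assumes "\<And>h. f (Suc h) 0 = f h 0"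
    and "\<And>h m. f (Suc h) (Suc m) = f h (Suc m) + f (Suc h) m + f (Suc (Suc h)) m"
  shows "Abs_fps (f (Suc h)) = Abs_fps (f h) + fps_X * (Abs_fps (f (Suc h)) + Abs_fps (f (Suc (Suc h))))"
proof (rule fps_ext)
  show "fps_nth (Abs_fps (f (Suc h))) m = fps_nth (Abs_fps (f h) +
      fps_X * (Abs_fps (f (Suc h)) + Abs_fps (f (Suc (Suc h))))) m" for m
    by (cases m) (simp_all add: assms)
qed

definition low_weight :: "nat \<Rightarrow> nat \<Rightarrow> nat \<Rightarrow> nat" where
  "low_weight t h m = (\<Sum>p\<in>paths_from h m. t ^ low_from (int h) p)"

lemma sum_Cons_image: "(\<Sum>p\<in>(#) s ` A. g p) = (\<Sum>p\<in>A. g (s # p))"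
  by (simp add: sum.reindex)

lemma sum_Cons_Un:
  assumes "finite A" "finite B" "s \<noteq> s'"
  shows "sum g ((#) s ` A \<union> (#) s' ` B) = (\<Sum>p\<in>A. g (s # p)) + (\<Sum>p\<in>B. g (s' # p))"
proof -
  have "(#) s ` A \<inter> (#) s' ` B = {}"
    using assms by blast
  then show ?thesis
    using assms by (simp add: sum.union_disjoint sum_Cons_image)
qed

lemma sum_Cons_Un3:
  assumes "finite A" "finite B" "finite C" "s \<noteq> s'" "s \<noteq> s''" "s' \<noteq> s''"
  shows "sum g ((#) s ` A \<union> ((#) s' ` B \<union> (#) s'' ` C)) =
    (\<Sum>p\<in>A. g (s # p)) + ((\<Sum>p\<in>B. g (s' # p)) + (\<Sum>p\<in>C. g (s'' # p)))"
proof -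
  have "(#) s ` A \<inter> ((#) s' ` B \<union> (#) s'' ` C) = {}"
    using assms by blast
  then show ?thesis
    using assms by (simp add: sum.union_disjoint sum_Cons_image sum_Cons_Un)
qed

lemma card_Cons_image: "card ((#) s ` A) = card A"
  by (simp add: card_image)

lemma low_weight_rec:
  "low_weight t 0 0 = 1"
  "low_weight t (Suc h) 0 = low_weight t h 0"
  "low_weight t 0 (Suc m) = t * low_weight t 0 m + low_weight t (Suc 0) m"
  "low_weight t (Suc h) (Suc m) =
     low_weight t h (Suc m) + low_weight t (Suc h) m + low_weight t (Suc (Suc h)) m"
  unfolding low_weight_def paths_from_0_0 paths_from_Suc_0 paths_from_0_Suc paths_from_Suc_Suc
  by (simp_all add: sum_Cons_image sum_Cons_Un sum_Cons_Un3 finite_paths_from sum_distrib_left add_ac)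

definition peakless_from :: "nat \<Rightarrow> nat \<Rightarrow> step list set" where
  "peakless_from h m = {p \<in> paths_from h m. low_from (int h) p = 0 \<and> \<not> peak1_from (int h) p}"

lemma finite_peakless_from: "finite (peakless_from h m)"
  by (simp add: peakless_from_def finite_paths_from)

text \<open>Only the recurrence on the axis differs in kind from \<open>low_weight_rec\<close>; its
  additive form avoids truncated subtraction.\<close>

lemma card_peakless_from_rec:
  "card (peakless_from 0 0) = 1"
  "card (peakless_from (Suc h) 0) = card (peakless_from h 0)"
  "card (peakless_from 0 (Suc m)) + card (peakless_from 0 m) = card (peakless_from (Suc 0) m)"
  "card (peakless_from (Suc h) (Suc m)) = card (peakless_from h (Suc m)) +
     card (peakless_from (Suc h) m) + card (peakless_from (Suc (Suc h)) m)"
proof -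
  have "peakless_from 0 0 = {[]}"
    by (auto simp: peakless_from_def paths_from_0_0)
  then show "card (peakless_from 0 0) = 1"
    by simp
  have "peakless_from (Suc h) 0 = (#) D ` peakless_from h 0"
    by (auto simp: peakless_from_def paths_from_Suc_0)
  then show "card (peakless_from (Suc h) 0) = card (peakless_from h 0)"
    by (simp add: card_Cons_image)
  have "peakless_from (Suc h) (Suc m) = (#) D ` peakless_from h (Suc m) \<union>
      ((#) H ` peakless_from (Suc h) m \<union> (#) U ` peakless_from (Suc (Suc h)) m)"
    by (auto simp: peakless_from_def paths_from_Suc_Suc add_ac)
  then show "card (peakless_from (Suc h) (Suc m)) = card (peakless_from h (Suc m)) +
     card (peakless_from (Suc h) m) + card (peakless_from (Suc (Suc h)) m)"
    unfolding card_eq_sum by (simp only:, subst sum_Cons_Un3) (simp_all add: finite_peakless_from)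
  \<comment> \<open>With low \<open>H\<close> and the peak \<open>U\<close>, \<open>D\<close>
    forbidden, a nonempty path from the axis is \<open>U\<close> followed by an element of
    \<open>?A\<close>. The other paths from height 1 start with \<open>D\<close>, which returns to
    the axis.\<close>
  let ?A = "{p \<in> peakless_from (Suc 0) m. hd p \<noteq> D}"
  have ne: "p \<noteq> []" if "p \<in> paths_from (Suc 0) m" for p
    using that Nil_in_paths_from by blast
  have "peakless_from 0 (Suc m) = (#) U ` ?A"
    using ne by (auto simp: peakless_from_def paths_from_0_Suc)
  then have "card (peakless_from 0 (Suc m)) = card ?A"
    by (simp add: card_Cons_image)
  moreover have "peakless_from (Suc 0) m = (#) D ` peakless_from 0 m \<union> ?A"
  proof -
    have "p \<in> (#) D ` peakless_from 0 m" if "p \<in> peakless_from (Suc 0) m" "hd p = D" for p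
      using that ne by (cases p) (auto simp: peakless_from_def D_in_paths_from)
    moreover have "(#) D ` peakless_from 0 m \<subseteq> peakless_from (Suc 0) m"
      by (auto simp: peakless_from_def D_in_paths_from)
    ultimately show ?thesis by blast
  qed
  moreover have "card ((#) D ` peakless_from 0 m \<union> ?A) = card (peakless_from 0 m) + card ?A"
    by (subst card_Un_disjoint) (auto simp: finite_peakless_from card_Cons_image)
  ultimately show "card (peakless_from 0 (Suc m)) + card (peakless_from 0 m) = card (peakless_from (Suc 0) m)"
    by simp
qed

text \<open>By uniqueness of ladders the series at height 1 is S times the one at height 0; the
  first-step equation on the axis then closes up. A rational \<open>c\<close> admits the weight
  -1.\<close>

lemma first_step_fps:
  fixes f :: "nat \<Rightarrow> nat \<Rightarrow> rat"
  assumes "f 0 0 = 1"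
    and "\<And>m. f 0 (Suc m) = c * f 0 m + f (Suc 0) m"
    and "\<And>h. f (Suc h) 0 = f h 0"
    and "\<And>h m. f (Suc h) (Suc m) = f h (Suc m) + f (Suc h) m + f (Suc (Suc h)) m"
  shows "Abs_fps (f 0) * (1 - fps_const c * fps_X - fps_X * large_fps) = 1"
proof -
  have "Abs_fps (f (Suc 0)) = Abs_fps (f 0) * ladder_fps (Suc 0)"
    by (rule fps_ladder_unique[of "\<lambda>h. Abs_fps (f h)"])
      (rule path_fps_ladder ladder_fps_Suc ladder_fps_0 assms)+
  moreover have "Abs_fps (f 0) =
      1 + fps_X * (fps_const c * Abs_fps (f 0) + Abs_fps (f (Suc 0)))"
  proof (rule fps_ext)
    show "fps_nth (Abs_fps (f 0)) m = fps_nth (1 + fps_X *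
        (fps_const c * Abs_fps (f 0) + Abs_fps (f (Suc 0)))) m" for m
      by (cases m) (simp_all add: assms)
  qed
  ultimately show ?thesis
    unfolding ladder_fps_1 by Groebner_Basis.algebra
qed

lemma low_weight_fps:
  "Abs_fps (\<lambda>m. of_nat (low_weight t 0 m)) *
     (1 - of_nat t * fps_X - fps_X * large_fps) = 1"
  using first_step_fps[of "\<lambda>h m. of_nat (low_weight t h m)" "of_nat t"]
  by (simp add: low_weight_rec fps_of_nat)

text \<open>Forbidding low steps and peaks of height 1 amounts to giving each low \<open>h\<close> step
  the weight \<open>- 1\<close>.\<close>

lemma peakless_fps:
  "Abs_fps (\<lambda>m. of_nat (card (peakless_from 0 m))) *
     (1 + fps_X - fps_X * large_fps) = 1"
proof -
  have "of_nat (card (peakless_from 0 (Suc m))) =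
      (- 1) * of_nat (card (peakless_from 0 m)) + (of_nat (card (peakless_from (Suc 0) m)) :: rat)" for m
    by (simp flip: card_peakless_from_rec(3))
  then have "Abs_fps (\<lambda>m. of_nat (card (peakless_from 0 m))) *
      (1 - fps_const (- 1) * fps_X - fps_X * large_fps) = 1"
    using card_peakless_from_rec by (intro first_step_fps) simp_all
  then show ?thesis
    by (simp flip: fps_const_neg)
qed

lemma A134425_conv: "A134425 n = low_weight 4 0 n"
  and A225887_conv: "A225887 n = low_weight 3 0 n"
  and A114710_conv: "A114710 n = card (peakless_from 0 n)"
  by (simp_all add: A134425_def A225887_def A114710_def low_weight_def peakless_from_def
      schroeder_paths_conv low_conv has_peak1_conv)

section \<open>Small Schroeder numbers and shifted series\<close>

definition small_fps :: "rat fps" where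
  "small_fps = Abs_fps small_schroeder"

text \<open>Halving fails only at index 0, where both sequences are 1; the summand 1 corrects
  this.\<close>

lemma small_fps_eq: "2 * small_fps = 1 + large_fps"
proof (rule fps_ext)
  show "fps_nth (2 * small_fps) n = fps_nth (1 + large_fps) n" for n
    by (cases n) (simp_all add: small_fps_def large_fps_def small_schroeder_def numeral_fps_const
        large_schroeder_def[of 0])
qed

lemma X_mult_large_fps_tl: "fps_X * Abs_fps (\<lambda>i. large_schroeder (1 + i)) = large_fps - 1"
proof (rule fps_ext)
  show "fps_nth (fps_X * Abs_fps (\<lambda>i. large_schroeder (1 + i))) n = fps_nth (large_fps - 1) n" for n
    by (cases n) (simp_all add: large_fps_def large_schroeder_def)
qed

lemma X_mult_small_fps_tl: "fps_X * Abs_fps (\<lambda>i. small_schroeder (1 + i)) = small_fps - 1"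
proof (rule fps_ext)
  show "fps_nth (fps_X * Abs_fps (\<lambda>i. small_schroeder (1 + i))) n = fps_nth (small_fps - 1) n" for n
    by (cases n) (simp_all add: small_fps_def small_schroeder_def)
qed

text \<open>The removed terms come from \<open>s_0 = s_1 = 1\<close>.\<close>

lemma X_mult_small_fps_tl_tl:
  "fps_X * (fps_X * Abs_fps (\<lambda>i. small_schroeder (2 + i))) = small_fps - 1 - fps_X"
proof (rule fps_ext)
  show "fps_nth (fps_X * (fps_X * Abs_fps (\<lambda>i. small_schroeder (2 + i)))) n =
      fps_nth (small_fps - 1 - fps_X) n" for n
  proof (cases n)
    case (Suc m)
    then show ?thesis
      by (cases m) (simp_all add: small_fps_def small_schroeder_def large_schroeder_def fps_X_nth)
  qed (simp add: small_fps_def small_schroeder_def)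
qed

text \<open>Doubled, the left side is \<open>(1 + S) (1 - x S) = 1 + S - x (S + S^2)\<close>, and
  the last term is \<open>S - 1\<close>.\<close>

lemma small_fps_mult: "small_fps * (1 - fps_X * large_fps) = 1"
proof -
  have "2 * (small_fps * (1 - fps_X * large_fps)) = 2 * 1"
    using large_fps_eq small_fps_eq by Groebner_Basis.algebra
  then show ?thesis
    by (subst (asm) mult_left_cancel) simp_all
qed

lemma large_fps_mult_small_fps: "(1 + fps_X * large_fps) * (1 - fps_X * small_fps) = 1"
proof -
  have "2 * ((1 + fps_X * large_fps) * (1 - fps_X * small_fps)) = 2 * 1"
    using large_fps_eq small_fps_eq by Groebner_Basis.algebra
  then show ?thesis
    by (subst (asm) mult_left_cancel) simp_all
qed

section \<open>The nine determinant formulas from explicit inverses\<close>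

theorem theorem3:
  fixes n :: nat
  assumes "n \<ge> 1"
  shows
    "(n \<ge> 2 \<longrightarrow>
       D_plus (map large_schroeder [1..<n + 1]) = (- 1) ^ (n - 1) * large_schroeder (n - 1)) \<and>
     D_minus (map large_schroeder [1..<n + 1]) = 2 * of_nat (A134425 (n - 1)) \<and>
     D_plus (map large_schroeder [0..<n]) = (- 1) ^ (n - 1) * small_schroeder (n - 1) \<and>
     D_minus (map large_schroeder [0..<n]) = small_schroeder n \<and>
     D_plus (map small_schroeder [1..<n + 1]) = (- 1) ^ (n - 1) * large_schroeder (n - 1) \<and>
     D_minus (map small_schroeder [1..<n + 1]) = of_nat (A225887 (n - 1)) \<and>
     D_plus (map small_schroeder [0..<n]) = (- 1) ^ (n - 1) * of_nat (A114710 (n - 1)) \<and>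
     D_minus (map small_schroeder [0..<n]) = large_schroeder (n - 1) \<and>
     (n \<ge> 2 \<longrightarrow>
       D_plus (map small_schroeder [2..<n + 2]) = (- 1) ^ (n - 1) * large_schroeder (n - 1))"
proof (intro conjI impI)
  obtain m where n: "n = Suc m"
    using assms by (cases n) auto
  define F4 F3 F1 :: "rat fps" where
    "F4 = Abs_fps (\<lambda>m. of_nat (low_weight 4 0 m))"
    and "F3 = Abs_fps (\<lambda>m. of_nat (low_weight 3 0 m))"
    and "F1 = Abs_fps (\<lambda>m. of_nat (card (peakless_from 0 m)))"
  have F4: "F4 * (1 - 4 * fps_X - fps_X * large_fps) = 1"
    using low_weight_fps[of 4] by (simp add: F4_def)
  have F3: "F3 * (1 - 3 * fps_X - fps_X * large_fps) = 1"
    using low_weight_fps[of 3] by (simp add: F3_def)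
  have F1: "F1 * (1 + fps_X - fps_X * large_fps) = 1"
    using peakless_fps by (simp add: F1_def)
  note L = large_fps_eq and s = small_fps_eq
  \<comment> \<open>\<open>small_fps\<close> is accessible to algebra only through its double, so
    identities are proved doubled.\<close>
  have two: "p = q" if "2 * p = 2 * q" for p q :: "rat fps"
    using that by (subst (asm) mult_left_cancel) simp_all
  show "D_plus (map large_schroeder [1..<n + 1]) = (- 1) ^ (n - 1) * large_schroeder (n - 1)"
    if "n \<ge> 2"
  proof -
    \<comment> \<open>The inverse of S is the quadratic equation rearranged. Its term
      \<open>- x\<close> disturbs the coefficient at 1, whence \<open>n \<ge> 2\<close>.\<close>
    have "(1 - fps_X - fps_X * large_fps) * (1 + (large_fps - 1)) = 1"
      using L by Groebner_Basis.algebra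
    from D_plus_eq[of _ large_schroeder 1 "n + 1" n, unfolded X_mult_large_fps_tl, OF this]
    show ?thesis
      using that by (simp add: n large_fps_def fps_X_nth)
  qed
  \<comment> \<open>Multiplied by the inverse of \<open>F4\<close>, this reads
    \<open>(1 - 2x - x S) (2 - S) = 1 - 4x - x S\<close>.\<close>
  have "(1 + 2 * (fps_X * F4)) * (1 - (large_fps - 1)) = 1"
    using L F4 by Groebner_Basis.algebra
  from D_minus_eq[of _ large_schroeder 1 "n + 1" n, unfolded X_mult_large_fps_tl, OF this]
  show "D_minus (map large_schroeder [1..<n + 1]) = 2 * of_nat (A134425 (n - 1))"
    by (simp add: n F4_def A134425_conv numeral_fps_const)
  have "(1 - fps_X * small_fps) * (1 + fps_X * large_fps) = 1"
    using large_fps_mult_small_fps by (simp only: mult.commute)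
  from D_plus_eq[of _ large_schroeder 0 n n, unfolded add_0, folded large_fps_def, OF this]
  show "D_plus (map large_schroeder [0..<n]) = (- 1) ^ (n - 1) * small_schroeder (n - 1)"
    by (simp add: n small_fps_def)
  from D_minus_eq[of _ large_schroeder 0 n n, unfolded add_0, folded large_fps_def, OF small_fps_mult]
  show "D_minus (map large_schroeder [0..<n]) = small_schroeder n"
    by (simp add: small_fps_def)
  have "(1 - fps_X * large_fps) * (1 + (small_fps - 1)) = 1"
    using small_fps_mult by (simp add: mult.commute)
  from D_plus_eq[of _ small_schroeder 1 "n + 1" n, unfolded X_mult_small_fps_tl, OF this]
  show "D_plus (map small_schroeder [1..<n + 1]) = (- 1) ^ (n - 1) * large_schroeder (n - 1)"
    by (simp add: n large_fps_def)
  \<comment> \<open>After doubling and clearing \<open>F3\<close>: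
    \<open>(1 - 2x - x S) (3 - S) = 2 (1 - 3x - x S)\<close>.\<close>
  have "(1 + fps_X * F3) * (1 - (small_fps - 1)) = 1"
    by (rule two) (use L s F3 in Groebner_Basis.algebra)
  from D_minus_eq[of _ small_schroeder 1 "n + 1" n, unfolded X_mult_small_fps_tl, OF this]
  show "D_minus (map small_schroeder [1..<n + 1]) = of_nat (A225887 (n - 1))"
    by (simp add: n F3_def A225887_conv)
  \<comment> \<open>Since \<open>s = 1 / (1 - x S)\<close>, both factors are quotients of
    \<open>1 - x S\<close> and \<open>1 + x - x S\<close>, in opposite order.\<close>
  have "(1 - fps_X * F1) * (1 + fps_X * small_fps) = 1"
    by (rule two) (use L s F1 in Groebner_Basis.algebra)
  from D_plus_eq[of _ small_schroeder 0 n n, unfolded add_0, folded small_fps_def, OF this]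
  show "D_plus (map small_schroeder [0..<n]) = (- 1) ^ (n - 1) * of_nat (A114710 (n - 1))"
    by (simp add: n F1_def A114710_conv)
  from D_minus_eq[of _ small_schroeder 0 n n, unfolded add_0, folded small_fps_def,
      OF large_fps_mult_small_fps]
  show "D_minus (map small_schroeder [0..<n]) = large_schroeder (n - 1)"
    by (simp add: n large_fps_def)
  show "D_plus (map small_schroeder [2..<n + 2]) = (- 1) ^ (n - 1) * large_schroeder (n - 1)"
    if "n \<ge> 2"
  proof -
    define T where "T = Abs_fps (\<lambda>i. small_schroeder (2 + i))"
    have T: "fps_X * (fps_X * T) = small_fps - 1 - fps_X"
      unfolding T_def by (rule X_mult_small_fps_tl_tl)
    \<comment> \<open>\<open>T\<close> is known only through \<open>x^2 T\<close>, hence the extra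
      factor x: \<open>x (1 + x T) = s - 1\<close>, and \<open>(1 - 2x - x S) (S - 1) = 2x\<close>.
      The term \<open>- 2x\<close> again forces \<open>n \<ge> 2\<close>.\<close>
    have "2 * (fps_X * ((1 - 2 * fps_X - fps_X * large_fps) * (1 + fps_X * T))) = 2 * (fps_X * 1)"
      using L s T by Groebner_Basis.algebra
    then have "(1 - 2 * fps_X - fps_X * large_fps) * (1 + fps_X * T) = 1"
      by (metis two mult_left_cancel fps_X_neq_zero)
    from D_plus_eq[of _ small_schroeder 2 "n + 2" n, folded T_def, OF this]
    show ?thesis
      using that by (simp add: n large_fps_def fps_X_nth numeral_fps_const)
  qed
qed

end
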